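(* Let $a_0,\dots,a_N$ be constants and put $P(x)=\sum_{\nu=0}^{N}a_\nu x^\nu$, where $P(-n)\neq 0$ for every integer $n\ge 1$. Let $(C(n))_{n\ge 1}$ be a sequence of numbers. Then the solution of the $N$-th degree linear differential equation $$\sum_{\nu=0}^{N}a_\nu\frac{d^\nu}{dx^\nu}u(x)=\sum_{n=1}^{\infty}\frac{\sum_{d\mid n}C(d)\mu(n/d)}{e^{nx}-1}=\sum_{n=1}^{\infty}C(n)e^{-nx}\qquad (x>0)$$ is $$u(x)=\sum_{n=1}^{\infty}\frac{\sum_{d\mid n}\frac{C(d)}{P(-d)}\mu(n/d)}{e^{nx}-1}=\sum_{n=1}^{\infty}\frac{C(n)}{P(-n)}e^{-nx}.$$
   Context: $\mu$ denotes the Möbius function, and $\sum_{d\mid n}$ is the sum over the positive divisors $d$ of $n$.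
   Formalization: The series of C(n)e^{-nx} is assumed to converge for all x > 0; "the solution" is read as: u is a solution, and the only one that is a convergent series of c(n)e^{-nx}, since solutions of the homogeneous equation may otherwise be added. *)

theory Defs
  imports "HOL-Analysis.Analysis" "HOL-Computational_Algebra.Computational_Algebra"
begin

definition moebius_mu :: "nat \<Rightarrow> int" where
  "moebius_mu n = (if squarefree n then (-1) ^ card (prime_factors n) else 0)"

text \<open>The divisor sum of \<open>C(d) \<mu>(n/d)\<close> over \<open>d | n\<close>; only used for \<open>n \<ge> 1\<close>.\<close>

definition moebius_sum :: "(nat \<Rightarrow> complex) \<Rightarrow> nat \<Rightarrow> complex" where
  "moebius_sum C n = (\<Sum>d | d dvd n. C d * of_int (moebius_mu (n div d)))"

text \<open>
  The series below start at \<open>n = 1\<close>, so the term with index \<open>k\<close> is the one for \<open>n = Suc k\<close>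
  and the value \<open>c 0\<close> never matters.
\<close>

definition exp_series_term :: "(nat \<Rightarrow> complex) \<Rightarrow> real \<Rightarrow> nat \<Rightarrow> complex" where
  "exp_series_term c x k = c (Suc k) * of_real (exp (- (real (Suc k) * x)))"

definition lambert_series_term :: "(nat \<Rightarrow> complex) \<Rightarrow> real \<Rightarrow> nat \<Rightarrow> complex" where
  "lambert_series_term b x k = b (Suc k) / of_real (exp (real (Suc k) * x) - 1)"

text \<open>
  \<^const>\<open>vector_derivative\<close> is total, with an unspecified value where the function is not
  differentiable; hence the explicit differentiability requirement in \<open>solves_linear_ode\<close>.
  Only the values of \<open>u\<close> on the open half-line matter there.
\<close>

definition higher_vector_derivative :: "nat \<Rightarrow> (real \<Rightarrow> complex) \<Rightarrow> real \<Rightarrow> complex" where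
  "higher_vector_derivative k u = ((\<lambda>g x. vector_derivative g (at x)) ^^ k) u"

definition solves_linear_ode ::
  "nat \<Rightarrow> (nat \<Rightarrow> complex) \<Rightarrow> (real \<Rightarrow> complex) \<Rightarrow> (real \<Rightarrow> complex) \<Rightarrow> bool" where
  "solves_linear_ode N a f u \<longleftrightarrow>
     (\<forall>x>0. (\<forall>k<N. higher_vector_derivative k u differentiable (at x)) \<and>
            (\<Sum>k\<le>N. a k * higher_vector_derivative k u x) = f x)"

end

theory Submission
  imports Defs "HOL-Complex_Analysis.Cauchy_Integral_Formula"
begin

text \<open>
  With \<open>q = exp (-x)\<close> an exponential series converging for all \<open>x > 0\<close> is a power series in \<open>q\<close>
  that converges absolutely on the unit disc. Hence it may be differentiated termwise, so that the
  differential operator multiplies the \<open>n\<close>-th coefficient by \<open>P(-n)\<close>, and its coefficients are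
  determined by its values. As \<open>|P(-n)|\<close> is bounded away from \<open>0\<close>, dividing by \<open>P(-n)\<close> preserves
  convergence. Expanding \<open>1 / (exp (n x) - 1)\<close> as the sum of \<open>q^(n m)\<close> over \<open>m \<ge> 1\<close> turns a Lambert
  series into an absolutely convergent double series; collecting the terms with \<open>n m = k\<close> and
  applying Moebius inversion gives the exponential series.
\<close>

subsection \<open>Moebius inversion\<close>

lemma moebius_mu_1 [simp]: "moebius_mu (Suc 0) = 1"
  by (simp add: moebius_mu_def)

text \<open>Coprimality of \<open>p\<close> and \<open>e\<close> leaves squarefreeness unchanged,
  while the new prime factor flips the sign.\<close>

lemma moebius_mu_prime_times:
  assumes "prime p" "\<not> p dvd e"
  shows "moebius_mu (p * e) = - moebius_mu e"
proof -
  have "e > 0" using assms by (cases e) auto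
  have cop: "coprime p e" using assms by (simp add: prime_imp_coprime)
  have "squarefree (p * e) \<longleftrightarrow> squarefree e"
    using cop assms(1) by (auto simp: squarefree_mult_coprime squarefree_prime dest: squarefree_multD)
  moreover have "prime_factors (p * e) = insert p (prime_factors e)"
    using assms \<open>e > 0\<close> by (simp add: prime_factors_product prime_prime_factors)
  moreover have "p \<notin> prime_factors e"
    using assms(2) by auto
  ultimately show ?thesis
    by (simp add: moebius_mu_def)
qed

lemma sum_moebius_mu_divisors:
  assumes "n > 0"
  shows "(\<Sum>d | d dvd n. moebius_mu d) = (if n = 1 then 1 else 0)"
proof (cases "n = 1")
  case False
  then obtain p where p: "prime p" "p dvd n"
    using prime_factor_nat by blast
  \<comment> \<open>A divisor \<open>d\<close> prime to \<open>p\<close> cancels against \<open>p * d\<close>; the others are divisible by \<open>p\<^sup>2\<close>.\<close>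
  let ?B = "{d. d dvd n \<and> \<not> p dvd d}"
  have fin: "finite {d. d dvd n}" using assms by simp
  have finB: "finite ?B" by (rule finite_subset[OF _ fin]) auto
  have sub: "?B \<union> (*) p ` ?B \<subseteq> {d. d dvd n}"
    using p by (auto intro!: divides_mult simp: prime_imp_coprime)
  have zero: "moebius_mu d = 0" if "d \<in> {d. d dvd n} - (?B \<union> (*) p ` ?B)" for d
  proof -
    from that have "p dvd d" "d dvd n" by auto
    then obtain e where e: "d = p * e" by (elim dvdE)
    have "e dvd n" using \<open>d dvd n\<close> e by (metis dvd_mult_right)
    with that e have "p dvd e" by auto
    then have "p ^ 2 dvd d" using e by (simp add: power2_eq_square)
    then have "\<not> squarefree d"
      using p(1) by (auto simp: squarefree_def dest!: spec[of _ p])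
    then show ?thesis by (simp add: moebius_mu_def)
  qed
  have "(\<Sum>d | d dvd n. moebius_mu d) = (\<Sum>d\<in>?B \<union> (*) p ` ?B. moebius_mu d)"
    by (rule sum.mono_neutral_right[OF fin sub]) (use zero in blast)
  also have "\<dots> = (\<Sum>d\<in>?B. moebius_mu d) + (\<Sum>d\<in>(*) p ` ?B. moebius_mu d)"
    by (rule sum.union_disjoint) (use finB in auto)
  also have "(\<Sum>d\<in>(*) p ` ?B. moebius_mu d) = (\<Sum>d\<in>?B. moebius_mu (p * d))"
    using p(1) by (subst sum.reindex) (auto intro!: inj_onI)
  also have "\<dots> = - (\<Sum>d\<in>?B. moebius_mu d)"
    by (subst sum_negf[symmetric], rule sum.cong) (use p(1) moebius_mu_prime_times in auto)
  finally show ?thesis using False by simp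
qed simp

text \<open>Writing \<open>n = d * m\<close> and summing over \<open>d\<close> first leaves the sum
  of \<open>moebius_mu\<close> over the divisors of \<open>k div d\<close>, which vanishes unless
  \<open>d = k\<close>.\<close>

lemma sum_moebius_sum_divisors:
  assumes "k > 0"
  shows "(\<Sum>n | n dvd k. moebius_sum C n) = C k"
proof -
  have fin: "finite {d. d dvd n}" if "n dvd k" for n
    using assms that by (metis dvd_0_left_iff finite_divisors_nat neq0_conv)
  have "(\<Sum>n | n dvd k. moebius_sum C n)
      = (\<Sum>(n,d)\<in>(SIGMA n:{n. n dvd k}. {d. d dvd n}). C d * of_int (moebius_mu (n div d)))"
    unfolding moebius_sum_def by (subst sum.Sigma) (use fin in auto)
  also have "\<dots> = (\<Sum>(d,m)\<in>(SIGMA d:{d. d dvd k}. {m. m dvd k div d}). C d * of_int (moebius_mu m))"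
    by (rule sum.reindex_bij_witness[where i = "\<lambda>(d,m). (d * m, d)" and j = "\<lambda>(n,d). (d, n div d)"])
       (use assms in \<open>auto elim!: dvdE\<close>)
  also have "\<dots> = (\<Sum>d | d dvd k. \<Sum>m | m dvd k div d. C d * of_int (moebius_mu m))"
    by (subst sum.Sigma) (use assms fin in \<open>auto elim!: dvdE\<close>)
  also have "\<dots> = (\<Sum>d | d dvd k. C d * of_int (\<Sum>m | m dvd k div d. moebius_mu m))"
    by (simp add: sum_distrib_left)
  also have "\<dots> = (\<Sum>d | d dvd k. if d = k then C d else 0)"
    by (intro sum.cong refl, subst sum_moebius_mu_divisors) (use assms in \<open>auto elim!: dvdE\<close>)
  also have "\<dots> = C k" using fin[of k] by simp
  finally show ?thesis .
qed


subsection \<open>Exponential series as power series\<close>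

lemma exp_series_term_power:
  "exp_series_term c x k = c (Suc k) * of_real (exp (- x)) ^ Suc k"
  by (simp add: exp_series_term_def flip: exp_of_nat_mult of_real_power del: power_Suc of_nat_Suc)

text \<open>Any \<open>r\<close> with \<open>norm z < r < 1\<close> equals \<open>exp (- x)\<close>
  for \<open>x = - ln r > 0\<close>. Convergence at \<open>r\<close> forces absolute convergence at
  the smaller modulus \<open>norm z\<close>.\<close>

lemma summable_norm_power_series:
  fixes c :: "nat \<Rightarrow> complex"
  assumes "\<And>x. x > 0 \<Longrightarrow> summable (exp_series_term c x)" "norm z < 1"
  shows "summable (\<lambda>n. norm (c n * z ^ n))"
proof -
  obtain r where r: "norm z < r" "r < 1" using assms(2) dense by blast
  have "r > 0" using r(1) norm_ge_zero[of z] by linarith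
  define x where "x = - ln r"
  have "x > 0" "exp (- x) = r" using r \<open>r > 0\<close> by (auto simp: x_def)
  with assms(1)[of x] have "summable (\<lambda>k. c (Suc k) * of_real r ^ Suc k)"
    unfolding exp_series_term_power[abs_def] by simp
  then have "summable (\<lambda>k. c k * of_real r ^ k)"
    using summable_Suc_iff by blast
  then show ?thesis
    by (rule powser_insidea) (use r \<open>r > 0\<close> in simp)
qed

lemma summable_power_series:
  fixes c :: "nat \<Rightarrow> complex"
  assumes "\<And>x. x > 0 \<Longrightarrow> summable (exp_series_term c x)" "norm z < 1"
  shows "summable (\<lambda>n. c n * z ^ n)"
  using summable_norm_power_series[OF assms] by (rule summable_norm_cancel)

text \<open>The full power series includes a constant term that the exponential series lacks, hence
  the correction by \<open>c 0\<close>.\<close>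

lemma exp_series_sums_power_series:
  assumes "\<And>x. x > 0 \<Longrightarrow> summable (exp_series_term c x)" "x > 0"
  shows "exp_series_term c x sums ((\<Sum>n. c n * of_real (exp (- x)) ^ n) - c 0)"
proof -
  have "(\<lambda>n. c n * of_real (exp (- x)) ^ n) sums (\<Sum>n. c n * of_real (exp (- x)) ^ n)"
    by (intro summable_sums summable_power_series assms(1)) (use assms(2) in auto)
  then show ?thesis
    unfolding exp_series_term_power[abs_def] by (subst sums_Suc_iff) simp
qed

lemma
  assumes c: "\<And>x. x > 0 \<Longrightarrow> summable (exp_series_term c x)" and x: "x > 0"
  defines "c' \<equiv> \<lambda>n. - of_nat n * c n"
  shows summable_exp_series_deriv: "summable (exp_series_term c' x)"
    and exp_series_has_vector_derivative:
      "((\<lambda>x. \<Sum>k. exp_series_term c x k) has_vector_derivative (\<Sum>k. exp_series_term c' x k)) (at x)"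
proof -
  define q :: complex where "q = of_real (exp (- x))"
  have q: "norm q < 1" using x by (simp add: q_def)
  have "(\<lambda>n. diffs c n * q ^ n) sums (\<Sum>n. diffs c n * q ^ n)"
    by (intro summable_sums termdiff_converges[OF q] summable_power_series c)
  \<comment> \<open>The inner derivative of \<open>exp (- x)\<close> is \<open>- q\<close>. This
    factor also raises the exponent by one, turning \<open>(k + 1) * c (k + 1) * q ^ k\<close> into
    the \<open>k\<close>-th term of the series for \<open>c'\<close>.\<close>
  from sums_mult2[OF this, of "- q"]
  have sums': "exp_series_term c' x sums ((\<Sum>n. diffs c n * q ^ n) * (- q))"
    by (simp add: exp_series_term_power[abs_def] c'_def diffs_def q_def mult_ac)
  then show "summable (exp_series_term c' x)" by (rule sums_summable)
  have d1: "((\<lambda>x. of_real (exp (- x)) :: complex) has_vector_derivative - q) (at x)"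
    unfolding q_def of_real_minus[symmetric]
    by (intro has_vector_derivative_of_real) (auto intro!: derivative_eq_intros simp flip: has_real_derivative_iff_has_vector_derivative)
  have d2: "((\<lambda>z. (\<Sum>n. c n * z ^ n) - c 0) has_field_derivative (\<Sum>n. diffs c n * q ^ n)) (at q)"
    using termdiffs_strong'[OF summable_power_series[OF c] q]
    by (auto intro!: derivative_eq_intros)
  have "((\<lambda>x. (\<Sum>n. c n * of_real (exp (- x)) ^ n) - c 0) has_vector_derivative
      - q * (\<Sum>n. diffs c n * q ^ n)) (at x)"
    using field_vector_diff_chain_at[OF d1 d2[unfolded q_def]] by (simp add: o_def q_def)
  also have "- q * (\<Sum>n. diffs c n * q ^ n) = (\<Sum>k. exp_series_term c' x k)"
    using sums_unique[OF sums'] by (simp add: mult.commute)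
  finally show "((\<lambda>x. \<Sum>k. exp_series_term c x k) has_vector_derivative (\<Sum>k. exp_series_term c' x k)) (at x)"
    by (rule has_vector_derivative_transform_within_open[where S = "{0<..}"])
       (use x sums_unique[OF exp_series_sums_power_series[OF c]] in auto)
qed

text \<open>The zeros of a nonzero power series are isolated, whereas the difference of the two
  series vanishes for all \<open>q\<close> in the interval from 0 to 1.\<close>

lemma exp_series_coeff_unique:
  assumes c: "\<And>x. x > 0 \<Longrightarrow> exp_series_term c x sums g x"
    and d: "\<And>x. x > 0 \<Longrightarrow> exp_series_term d x sums g x"
    and "n \<ge> 1"
  shows "c n = d n"
proof (rule ccontr)
  assume "c n \<noteq> d n"
  \<comment> \<open>The values \<open>c 0\<close> and \<open>d 0\<close> are arbitrary, so index 0
    is reset; this gives \<open>F 0 = 0\<close>, as \<open>powser_0_nonzero\<close>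
    requires.\<close>
  define a where "a m = (if m = 0 then 0 else c m - d m)" for m
  have a_term: "exp_series_term a x = (\<lambda>k. exp_series_term c x k - exp_series_term d x k)" for x
    by (auto simp: exp_series_term_def a_def algebra_simps)
  have a_sums: "exp_series_term a x sums 0" if "x > 0" for x
    unfolding a_term using sums_diff[OF c[OF that] d[OF that]] by simp
  define F where "F z = (\<Sum>n. a n * z ^ n)" for z
  have F: "(\<lambda>n. a n * (z - 0) ^ n) sums F z" if "norm (z - 0) < 1" for z
    using that unfolding F_def
    by (auto intro!: summable_sums summable_power_series sums_summable[OF a_sums])
  have "F 0 = 0" by (simp add: F_def a_def)
  moreover have "a n \<noteq> 0" "n > 0" using \<open>c n \<noteq> d n\<close> \<open>n \<ge> 1\<close> by (auto simp: a_def)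
  ultimately obtain s where s: "s > 0" "\<And>z. z \<in> cball 0 s - {0} \<Longrightarrow> F z \<noteq> 0"
    using powser_0_nonzero[OF zero_less_one F] by metis
  \<comment> \<open>A point of the zero-free punctured disc that is also below 1, so that
    \<open>r = exp (- x)\<close> with \<open>x = - ln r > 0\<close>.\<close>
  define r where "r = min s (1/2)"
  have r: "r > 0" "r < 1" "r \<le> s" using s(1) by (auto simp: r_def)
  have "F (of_real r) = 0"
    using sums_unique2[OF exp_series_sums_power_series[OF sums_summable[OF a_sums], of "- ln r"]
        a_sums[of "- ln r"]] r
    by (simp add: F_def a_def)
  moreover have "F (of_real r) \<noteq> 0"
    by (rule s(2)) (use r in auto)
  ultimately show False by contradiction
qed


subsection \<open>Lambert series\<close>

text \<open>Translates between unordered sums over \<open>n \<ge> 1\<close>, convenient for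
  rearrangement, and the series indexed from 0.\<close>

lemma has_sum_atLeast_1_iff: "(f has_sum S) {1::nat..} \<longleftrightarrow> ((\<lambda>n. f (Suc n)) has_sum S) UNIV"
  by (rule has_sum_reindex_bij_betw[symmetric]) (rule bij_betw_byWitness[where f' = "\<lambda>n. n - 1"], auto)

lemma summable_norm_moebius_sum_power:
  assumes c: "\<And>x. x > 0 \<Longrightarrow> summable (exp_series_term c x)" and x: "x > 0"
  shows "summable (\<lambda>n. norm (moebius_sum c (Suc n)) * exp (- x) ^ Suc n)"
proof -
  \<comment> \<open>One factor \<open>r ^ n\<close> absorbs the growth of the coefficients, the other gives convergence.\<close>
  define r where "r = exp (- x / 2)"
  have r: "r > 0" "r < 1" "r\<^sup>2 = exp (- x)"
    using x by (auto simp: r_def simp flip: exp_of_nat_mult)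
  have "summable (\<lambda>n. norm (c n * of_real r ^ n))"
    by (rule summable_norm_power_series[OF c]) (use r in auto)
  then have "Bseq (\<lambda>n. norm (c n * of_real r ^ n))"
    by (rule summable_imp_Bseq)
  then obtain K where K: "\<And>n. norm (c n * of_real r ^ n) \<le> K" "K > 0"
    by (auto simp: Bseq_def)
  have c_le: "norm (c d) * r ^ n \<le> K" if "d dvd n" "n > 0" for d n
  proof -
    have "norm (c d) * r ^ n \<le> norm (c d) * r ^ d"
      using that r by (intro mult_left_mono power_decreasing) (auto dest: dvd_imp_le)
    also have "\<dots> \<le> K" using K(1)[of d] r by (simp add: norm_mult norm_power)
    finally show ?thesis .
  qed
  have mu: "norm (of_int (moebius_mu m) :: complex) \<le> 1" for m
    by (simp add: moebius_mu_def norm_power)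
  \<comment> \<open>Each of the at most \<open>n\<close> divisors contributes at most
    \<open>K\<close>, because every \<open>d dvd n\<close> satisfies \<open>d \<le> n\<close> and
    hence \<open>r ^ n \<le> r ^ d\<close>.\<close>
  have b_le: "norm (moebius_sum c n) * r ^ n \<le> of_nat n * K" if "n > 0" for n
  proof -
    have "norm (moebius_sum c n) * r ^ n \<le> (\<Sum>d | d dvd n. norm (c d)) * r ^ n"
      unfolding moebius_sum_def
      by (intro mult_right_mono sum_norm_le) (use r mu in \<open>auto simp: norm_mult intro!: mult_left_le\<close>)
    also have "\<dots> \<le> (\<Sum>d | d dvd n. K)"
      unfolding sum_distrib_right by (intro sum_mono c_le) (use that in auto)
    also have "\<dots> = of_nat (card {d. d dvd n}) * K" by simp
    also have "\<dots> \<le> of_nat n * K"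
    proof -
      have "card {d. d dvd n} \<le> card {1..n}"
        by (intro card_mono) (use that in \<open>auto dest: dvd_imp_le intro!: Suc_leI Nat.gr0I\<close>)
      then show ?thesis using K(2) by simp
    qed
    finally show ?thesis .
  qed
  have "summable (\<lambda>n. of_nat (Suc n) * r ^ n)"
    using geometric_deriv_sums[of r] r by (auto simp: sums_iff)
  then have "summable (\<lambda>n. (K * r) * (of_nat (Suc n) * r ^ n))"
    by (rule summable_mult)
  then show ?thesis
  proof (rule summable_comparison_test')
    fix n :: nat
    have "norm (moebius_sum c (Suc n)) * exp (- x) ^ Suc n
        = (norm (moebius_sum c (Suc n)) * r ^ Suc n) * r ^ Suc n"
      unfolding r(3)[symmetric] by (simp add: power2_eq_square power_mult_distrib mult_ac)
    also have "\<dots> \<le> (of_nat (Suc n) * K) * r ^ Suc n"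
      by (intro mult_right_mono b_le) (use r in auto)
    finally show "norm (norm (moebius_sum c (Suc n)) * exp (- x) ^ Suc n)
        \<le> (K * r) * (of_nat (Suc n) * r ^ n)"
      by (simp add: mult_ac)
  qed
qed

lemma lambert_series_sums:
  assumes c: "\<And>x. x > 0 \<Longrightarrow> summable (exp_series_term c x)" and x: "x > 0"
  shows "lambert_series_term (moebius_sum c) x sums (\<Sum>k. exp_series_term c x k)"
proof -
  define b where "b = moebius_sum c"
  define q where "q = exp (- x)"
  have q: "0 < q" "q < 1" using x by (auto simp: q_def)
  have qn: "0 < q ^ n" "q ^ n \<le> q" "q ^ n < 1" if "n \<ge> 1" for n
    using q that power_decreasing[of 1 n q] by auto
  have geo: "((\<lambda>m. q ^ (n * m)) has_sum (q ^ n / (1 - q ^ n))) {1..}" if "n \<ge> 1" for n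
  proof -
    have "(\<lambda>m. q ^ n * (q ^ n) ^ m) sums (q ^ n * (1 / (1 - q ^ n)))"
      by (intro sums_mult geometric_sums) (use qn[OF that] in auto)
    then have "(\<lambda>m. q ^ (n * Suc m)) sums (q ^ n / (1 - q ^ n))"
      by (simp add: power_add power_mult)
    then show ?thesis
      unfolding has_sum_atLeast_1_iff
      by (intro norm_summable_imp_has_sum) (use q in \<open>auto simp: sums_iff\<close>)
  qed
  define f :: "nat \<times> nat \<Rightarrow> complex" where "f = (\<lambda>(n, m). b n * of_real (q ^ (n * m)))"
  have "(\<lambda>p. norm (f p)) summable_on {1..} \<times> {1..}"
  proof (rule summable_on_SigmaI)
    show "((\<lambda>m. norm (f (n, m))) has_sum (norm (b n) * (q ^ n / (1 - q ^ n)))) {1..}"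
      if "n \<in> {1..}" for n
      using has_sum_cmult_right[OF geo, of n "norm (b n)"] that q
      by (simp add: f_def norm_mult norm_power)
    \<comment> \<open>Since \<open>q ^ n \<le> q\<close> for \<open>n \<ge> 1\<close>, the
      denominators \<open>1 - q ^ n\<close> are uniformly at least \<open>1 - q\<close>, so this
      series is a majorant.\<close>
    have "summable (\<lambda>n. norm (b (Suc n)) * q ^ Suc n * (1 / (1 - q)))"
      unfolding b_def q_def by (intro summable_mult2 summable_norm_moebius_sum_power c x)
    then have "summable (\<lambda>n. norm (norm (b (Suc n)) * (q ^ Suc n / (1 - q ^ Suc n))))"
    proof (rule summable_comparison_test')
      fix n :: nat
      have "q ^ Suc n / (1 - q ^ Suc n) \<le> q ^ Suc n / (1 - q)"
        using qn[of "Suc n"] q by (intro divide_left_mono) auto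
      then have "norm (b (Suc n)) * (q ^ Suc n / (1 - q ^ Suc n)) \<le> norm (b (Suc n)) * (q ^ Suc n / (1 - q))"
        by (intro mult_left_mono) auto
      then show "norm (norm (norm (b (Suc n)) * (q ^ Suc n / (1 - q ^ Suc n))))
          \<le> norm (b (Suc n)) * q ^ Suc n * (1 / (1 - q))"
        using qn[of "Suc n"] by (simp add: abs_mult)
    qed
    then show "(\<lambda>n. norm (b n) * (q ^ n / (1 - q ^ n))) summable_on {1..}"
      unfolding summable_on_def has_sum_atLeast_1_iff
      by (rule norm_summable_imp_summable_on[unfolded summable_on_def])
  qed auto
  then have "f summable_on {1..} \<times> {1..}"
    by (rule abs_summable_summable)
  then obtain S where S: "(f has_sum S) ({1..} \<times> {1..})"
    by (auto simp: summable_on_def)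
  have "((\<lambda>n. b n * of_real (q ^ n / (1 - q ^ n))) has_sum S) {1..}"
  proof (rule has_sum_SigmaD[OF S])
    fix n :: nat assume "n \<in> {1..}"
    then show "((\<lambda>m. f (n, m)) has_sum b n * of_real (q ^ n / (1 - q ^ n))) {1..}"
      unfolding f_def prod.case
      by (intro has_sum_cmult_right has_sum_of_real geo) auto
  qed
  then have "(\<lambda>n. b (Suc n) * of_real (q ^ Suc n / (1 - q ^ Suc n))) sums S"
    unfolding has_sum_atLeast_1_iff by (rule has_sum_imp_sums)
  moreover have "b (Suc n) * of_real (q ^ Suc n / (1 - q ^ Suc n)) = lambert_series_term b x n" for n
  proof -
    have "exp (real (Suc n) * x) = 1 / q ^ Suc n"
      by (simp add: q_def exp_minus field_simps flip: exp_of_nat_mult del: power_Suc of_nat_Suc)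
    then have "1 / (exp (real (Suc n) * x) - 1) = q ^ Suc n / (1 - q ^ Suc n)"
      using qn[of "Suc n"] by (simp only:) (simp add: divide_simps)
    then show ?thesis
      unfolding lambert_series_term_def by (metis divide_inverse inverse_eq_divide of_real_inverse)
  qed
  ultimately have lambert: "lambert_series_term b x sums S" by simp

  \<comment> \<open>The same double sum \<open>S\<close> is now grouped by the product
    \<open>k = n * m\<close>. Each group is finite, and its coefficients \<open>b n\<close> add up
    to \<open>c k\<close> by Moebius inversion.\<close>
  have bij: "bij_betw (\<lambda>(k, n). (n, k div n)) (SIGMA k:{1..}. {n. n dvd k}) ({1..} \<times> {1::nat..})"
    by (rule bij_betwI[where g = "\<lambda>(n, m). (n * m, n)"]) (auto elim!: dvdE simp: Suc_le_eq)
  have "((\<lambda>(k, n). b n * of_real (q ^ k)) has_sum S) (SIGMA k:{1..}. {n. n dvd k})"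
    using S unfolding has_sum_reindex_bij_betw[OF bij, of f, symmetric]
    by (rule has_sum_cong[THEN iffD1, rotated]) (auto simp: f_def)
  then have "((\<lambda>k. c k * of_real (q ^ k)) has_sum S) {1..}"
  proof (rule has_sum_SigmaD)
    fix k :: nat assume k: "k \<in> {1..}"
    then show "((\<lambda>n. case (k, n) of (k, n) \<Rightarrow> b n * of_real (q ^ k)) has_sum c k * of_real (q ^ k)) {n. n dvd k}"
      unfolding prod.case
      by (intro has_sum_finiteI)
         (auto simp: b_def sum_moebius_sum_divisors simp flip: sum_distrib_right)
  qed
  then have "exp_series_term c x sums S"
    unfolding has_sum_atLeast_1_iff exp_series_term_power[abs_def] q_def of_real_power
    by (rule has_sum_imp_sums)
  with lambert show ?thesis by (simp add: b_def sums_iff)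
qed


subsection \<open>The differential equation\<close>

lemma higher_vector_derivative_Suc:
  "higher_vector_derivative (Suc k) v x = vector_derivative (higher_vector_derivative k v) (at x)"
  by (simp add: higher_vector_derivative_def)

text \<open>Differentiability at \<open>x\<close> is local, so agreement with the series on the open
  half-line suffices, whatever \<open>v\<close> does elsewhere. This lets the induction on
  derivatives treat \<open>higher_vector_derivative k v\<close> as the next
  \<open>v\<close>.\<close>

lemma exp_series_sums_has_vector_derivative:
  assumes v: "\<And>x. x > 0 \<Longrightarrow> exp_series_term c x sums v x" and x: "x > 0"
  shows "(v has_vector_derivative (\<Sum>k. exp_series_term (\<lambda>n. - of_nat n * c n) x k)) (at x)"
  by (rule has_vector_derivative_transform_within_open[where S = "{0<..}",
        OF exp_series_has_vector_derivative[OF sums_summable[OF v]]])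
     (use x sums_unique[OF v] in auto)

lemma exp_series_higher_derivative_sums:
  assumes v: "\<And>x. x > 0 \<Longrightarrow> exp_series_term c x sums v x" and x: "x > 0"
  shows "exp_series_term (\<lambda>n. (- of_nat n) ^ k * c n) x sums higher_vector_derivative k v x"
  using x
proof (induction k arbitrary: x)
  case 0
  then show ?case using v by (simp add: higher_vector_derivative_def)
next
  case (Suc k)
  have "higher_vector_derivative (Suc k) v x
      = (\<Sum>j. exp_series_term (\<lambda>n. - of_nat n * ((- of_nat n) ^ k * c n)) x j)"
    unfolding higher_vector_derivative_Suc
    by (rule vector_derivative_at, rule exp_series_sums_has_vector_derivative) (use Suc in auto)
  moreover have "summable (exp_series_term (\<lambda>n. - of_nat n * ((- of_nat n) ^ k * c n)) x)"
    by (rule summable_exp_series_deriv) (use Suc sums_summable in auto)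
  ultimately show ?case by (simp add: sums_iff mult.assoc)
qed

lemma exp_series_higher_derivative_differentiable:
  assumes v: "\<And>x. x > 0 \<Longrightarrow> exp_series_term c x sums v x" and x: "x > 0"
  shows "higher_vector_derivative k v differentiable (at x)"
  using exp_series_sums_has_vector_derivative[OF exp_series_higher_derivative_sums[OF v] x]
  by (rule differentiableI_vector)

text \<open>Serves both directions: it verifies the equation for \<open>u\<close> and extracts the
  coefficients of any competing solution.\<close>

lemma exp_series_linear_ode_sums:
  assumes v: "\<And>x. x > 0 \<Longrightarrow> exp_series_term c x sums v x" and x: "x > 0"
  shows "exp_series_term (\<lambda>n. (\<Sum>k\<le>N. a k * (- of_nat n) ^ k) * c n) x
           sums (\<Sum>k\<le>N. a k * higher_vector_derivative k v x)"
proof -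
  have "(\<lambda>j. \<Sum>k\<le>N. a k * exp_series_term (\<lambda>n. (- of_nat n) ^ k * c n) x j)
          sums (\<Sum>k\<le>N. a k * higher_vector_derivative k v x)"
    by (intro sums_sum sums_mult exp_series_higher_derivative_sums[OF v] x)
  then show ?thesis
    by (rule sums_cong[THEN iffD1, rotated]) (simp add: exp_series_term_def sum_distrib_right mult.assoc)
qed

text \<open>A nonconstant polynomial tends to infinity in modulus, so only finitely many
  \<open>n\<close> can give values below 1, and none of these values is 0. A constant polynomial
  equals \<open>a 0\<close>, which is nonzero by the case \<open>n = 1\<close>.\<close>

lemma polyfun_neg_nat_bounded_below:
  fixes a :: "nat \<Rightarrow> complex"
  assumes nz: "\<And>n::nat. n \<ge> 1 \<Longrightarrow> (\<Sum>k\<le>N. a k * (- of_nat n) ^ k) \<noteq> 0"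
  obtains \<delta> where "\<delta> > 0" "\<And>n::nat. n \<ge> 1 \<Longrightarrow> \<delta> \<le> norm (\<Sum>k\<le>N. a k * (- of_nat n) ^ k)"
proof (cases "\<exists>k. k \<noteq> 0 \<and> k \<le> N \<and> a k \<noteq> 0")
  case True
  let ?p = "\<lambda>n::nat. norm (\<Sum>k\<le>N. a k * (- of_nat n) ^ k)"
  obtain B where B: "\<And>z. norm z \<ge> B \<Longrightarrow> 1 \<le> norm (\<Sum>k\<le>N. a k * z ^ k)"
    using polyfun_extremal[OF True, of 1] by (auto simp: eventually_at_infinity)
  define M where "M = nat \<lceil>B\<rceil>"
  have large: "1 \<le> ?p n" if "n > M" for n
    by (rule B) (use that in \<open>simp add: M_def, linarith\<close>)
  \<comment> \<open>The element 1 covers all \<open>n > M\<close> and keeps the set nonempty when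
    \<open>M = 0\<close>.\<close>
  let ?\<delta> = "Min (insert 1 (?p ` {1..M}))"
  show thesis
  proof
    show "?\<delta> > 0" using nz by (subst Min_gr_iff) auto
    show "?\<delta> \<le> ?p n" if "n \<ge> 1" for n
    proof (cases "n \<le> M")
      case True
      then show ?thesis using that by (intro Min_le) auto
    next
      case False
      then have "1 \<le> ?p n" by (intro large) simp
      then show ?thesis by (intro order.trans[OF Min_le]) auto
    qed
  qed
next
  case False
  then have "(\<Sum>k\<le>N. a k * z ^ k) = a 0" for z
    by (subst sum.mono_neutral_right[of _ "{0}"]) auto
  then show thesis using that[of "norm (a 0)"] nz[of 1] by auto
qed

text \<open>Uniqueness is claimed among sums of exponential series: a homogeneous solution
  \<open>exp (w * x)\<close> with \<open>P w = 0\<close> may be added to \<open>u\<close> without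
  violating the equation.\<close>

theorem lemma1:
  fixes N :: nat and a C D :: "nat \<Rightarrow> complex" and P :: "complex \<Rightarrow> complex"
    and f u :: "real \<Rightarrow> complex"
  assumes P: "\<And>z. P z = (\<Sum>k\<le>N. a k * z ^ k)"
    and P_nonzero: "\<And>n::nat. n \<ge> 1 \<Longrightarrow> P (- of_nat n) \<noteq> 0"
    and f: "\<And>x. x > 0 \<Longrightarrow> exp_series_term C x sums f x"
    and D: "\<And>n::nat. n \<ge> 1 \<Longrightarrow> D n = C n / P (- of_nat n)"
    and u: "\<And>x. x > 0 \<Longrightarrow> u x = (\<Sum>k. exp_series_term D x k)"
  shows "(\<forall>x>0. lambert_series_term (moebius_sum C) x sums f x) \<and>
         (\<forall>x>0. exp_series_term D x sums u x) \<and>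
         (\<forall>x>0. lambert_series_term (moebius_sum D) x sums u x) \<and>
         solves_linear_ode N a f u \<and>
         (\<forall>c v. (\<forall>x>0. exp_series_term c x sums v x) \<and> solves_linear_ode N a f v
                  \<longrightarrow> (\<forall>x>0. v x = u x))"
proof -
  have C_sum: "summable (exp_series_term C x)" if "x > 0" for x
    using f[OF that] by (rule sums_summable)
  obtain \<delta> where \<delta>: "\<delta> > 0" "\<And>n::nat. n \<ge> 1 \<Longrightarrow> \<delta> \<le> norm (P (- of_nat n))"
    using polyfun_neg_nat_bounded_below[of a N] P_nonzero unfolding P by blast
  \<comment> \<open>Comparison with the series for \<open>C\<close> divided by
    \<open>\<delta>\<close>; it rests on the absolute convergence of that series, not merely its
    convergence.\<close>
  have D_sum: "summable (exp_series_term D x)" if x: "x > 0" for x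
  proof -
    let ?q = "of_real (exp (- x)) :: complex"
    have "summable (\<lambda>n. norm (C n * ?q ^ n))"
      by (rule summable_norm_power_series[OF C_sum]) (use x in auto)
    then have "summable (\<lambda>n. norm (C (Suc n) * ?q ^ Suc n))"
      by (subst summable_Suc_iff)
    then have "summable (\<lambda>n. norm (C (Suc n) * ?q ^ Suc n) / \<delta>)"
      by (rule summable_divide)
    then show ?thesis
    proof (rule summable_comparison_test')
      fix n :: nat
      have "norm (exp_series_term D x n)
          = norm (C (Suc n) * ?q ^ Suc n) / norm (P (- of_nat (Suc n)))"
        using D[of "Suc n"] by (simp add: exp_series_term_power norm_mult norm_divide)
      also have "\<dots> \<le> norm (C (Suc n) * ?q ^ Suc n) / \<delta>"
        using \<delta>(1) \<delta>(2)[of "Suc n"] by (intro divide_left_mono mult_pos_pos) auto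
      finally show "norm (exp_series_term D x n) \<le> norm (C (Suc n) * ?q ^ Suc n) / \<delta>" .
    qed
  qed
  have u_sums: "exp_series_term D x sums u x" if "x > 0" for x
    using D_sum[OF that] u[OF that] by (simp add: sums_iff)
  have lambert_C: "lambert_series_term (moebius_sum C) x sums f x" if "x > 0" for x
    using lambert_series_sums[OF C_sum that] sums_unique[OF f[OF that]] by simp
  have lambert_D: "lambert_series_term (moebius_sum D) x sums u x" if "x > 0" for x
    using lambert_series_sums[OF D_sum that] u[OF that] by simp
  \<comment> \<open>The factor \<open>P (- of_nat n)\<close> undoes the division in
    \<open>D\<close>. The terms only involve \<open>n \<ge> 1\<close>, so equality holds although
    \<open>D 0\<close> is arbitrary.\<close>
  have "exp_series_term (\<lambda>n. (\<Sum>k\<le>N. a k * (- of_nat n) ^ k) * D n) = exp_series_term C"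
    using D P_nonzero by (intro ext) (simp add: exp_series_term_def flip: P del: of_nat_Suc)
  then have ode: "(\<Sum>k\<le>N. a k * higher_vector_derivative k u x) = f x" if "x > 0" for x
    using exp_series_linear_ode_sums[OF u_sums that, of a N] f[OF that] sums_unique2 by metis
  have unique: "v x = u x"
    if v: "\<And>x. x > 0 \<Longrightarrow> exp_series_term c x sums v x"
      and v_ode: "solves_linear_ode N a f v" and x: "x > 0" for c v x
  proof -
    \<comment> \<open>Applying the operator to \<open>v\<close> yields a second exponential
      expansion of \<open>f\<close>, so the coefficients must match those of
      \<open>C\<close>.\<close>
    have "(\<Sum>k\<le>N. a k * (- of_nat n) ^ k) * c n = C n" if "n \<ge> 1" for n
    proof (rule exp_series_coeff_unique[OF _ f that])
      fix x :: real assume "x > 0"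
      then show "exp_series_term (\<lambda>n. (\<Sum>k\<le>N. a k * (- of_nat n) ^ k) * c n) x sums f x"
        using exp_series_linear_ode_sums[OF v, of x a N] v_ode
        by (simp add: solves_linear_ode_def)
    qed
    then have "c n = D n" if "n \<ge> 1" for n
      unfolding D[OF that] using that P_nonzero[OF that]
      by (subst eq_divide_eq) (auto simp: P mult.commute)
    then have "exp_series_term c x = exp_series_term D x"
      by (intro ext) (simp add: exp_series_term_def)
    then show ?thesis
      using sums_unique2[OF v[OF x]] u_sums[OF x] by simp
  qed
  show ?thesis
    using lambert_C u_sums lambert_D ode unique
      exp_series_higher_derivative_differentiable[OF u_sums]
    unfolding solves_linear_ode_def[of N a f u] by blast
qed

end
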